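(* Fix a design policy $\pi=\{\mu_k\}_{k=0}^{N-1}$. Then an optimal stopping policy $\psi^\ast=\{\varphi_k^\ast\}_{k=0}^{N-1}$ for $\pi$ (there is a maximizer $\psi^\ast$ of $\psi\mapsto U(\pi,\psi)$ over all stopping policies with the following form) satisfies $$\varphi_k^\ast(s_k)=\mathbf{1}_{s_k\in\mathcal{T}_k},\qquad k=0,\ldots,N-1,$$ where the stopping set $\mathcal{T}_k\subseteq\mathcal{S}$ is $$\mathcal{T}_k=\left\{s_k\in\mathcal{S}:\ r_T^S(s_k)\ \ge\ Q_k^{\pi,\psi^\ast}\big(s_k,\mu_k(s_k)\big)\right\}.$$ Equivalently, $\psi^\ast$ stops at stage $k$ in state $s_k$ exactly when $$r_T^S(s_k)\ \ge\ \mathbb{E}_{Y_k|s_k,\mu_k(s_k)}\left[r_k^C(s_k,\mu_k(s_k),Y_k)+V_{k+1}^{\pi,\psi^\ast}\big(\mathcal{F}_k(s_k,\mu_k(s_k),Y_k)\big)\right].$$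
   Context: **Bayesian model.** At most $N$ experiments, indexed $k=0,\ldots,N-1$, are performed. $\Theta\in\mathbb{R}^p$ is an unknown random parameter with prior density $p(\theta|I_0)$. Experiment $k$ has a design $\xi_k\in\Xi_k\subseteq\mathbb{R}^d$ and an observation $Y_k\in\mathbb{R}^n$; the history before experiment $k$ is $I_k=\{\xi_0,y_0,\ldots,\xi_{k-1},y_{k-1}\}$, $I_0=\emptyset$. Observations satisfy $Y_k=G_k(\Theta,\xi_k;I_k)+\mathcal{E}_k$, where $G_k$ is a given forward map and $\mathcal{E}_k\in\mathbb{R}^n$ is noise with known density $p_\epsilon$, conditionally independent across stages given $(\theta,\xi_k,I_k)$. This gives the likelihood $p(y_k|\theta,\xi_k,I_k)$, the marginal likelihood (predictive density) $p(y_k|\xi_k,I_k)=\int p(y_k|\theta,\xi_k,I_k)\,p(\theta|I_k)\,d\theta$, and the updated density $p(\theta|I_{k+1})=p(y_k|\theta,\xi_k,I_k)p(\theta|I_k)/p(y_k|\xi_k,I_k)$. $p_{\Theta|I_k}$ denotes the distribution of $\Theta$ with density $p(\theta|I_k)$, and $D_{\mathrm{KL}}$ is Kullback–Leibler divergence. **States and policies.** The state $s_k\in\mathcal{S}$ at stage $k$ contains the current belief about $\Theta$ and all deterministic information needed for future decisions and for the rewards (for instance $s_k=I_k$); $s_0$ is a fixed initial state. There is also a terminal state $T$, reached once experimentation stops. A design policy is $\pi=\{\mu_k:\mathcal{S}\to\Xi_k\}_{k=0}^{N-1}$; a stopping policy is $\psi=\{\varphi_k:\mathcal{S}\to\{0,1\}\}_{k=0}^{N-1}$,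 with $\varphi_k(s_k)=1$ meaning stop and $0$ meaning continue. Under $(\pi,\psi)$, if $s_k\ne T$ and $\varphi_k(s_k)=0$, then $\xi_k=\mu_k(s_k)$, $Y_k$ is drawn from the predictive distribution given $(s_k,\xi_k)$, and $s_{k+1}=\mathcal{F}_k(s_k,\xi_k,Y_k)$, where $\mathcal{F}_k$ encodes the Bayesian update and any deterministic evolution; otherwise $s_{k+1}=T$. If no stopping occurs before stage $N$, the process terminates at $s_N$. **Rewards.** $c_k(\xi_k)\le 0$ is the cost of experiment $k$. The rewards $r_k$ (stage) and $r_T$ (terminal) are given by either of two formulations: - Terminal formulation: $r_k=0$, and $r_T(s_k)=D_{\mathrm{KL}}(p_{\Theta|I_k}\,||\,p_{\Theta|I_0})+\sum_{i=0}^{k-1}c_i(\xi_i)$ if $s_k\ne T$ and ($k<N$ and $\varphi_k(s_k)=1$, or $k=N$); $r_T(s_k)=0$ otherwise. - Incremental formulation: $r_k(s_k,\xi_k,y_k)=D_{\mathrm{KL}}(p_{\Theta|I_{k+1}}\,||\,p_{\Theta|I_k})+c_k(\xi_k)$ if $s_k\ne T$ and $\varphi_k(s_k)=0$, and $0$ otherwise; $r_T=0$. $r_T^S(s_k)$ denotes the terminal reward that would be collected if stopping were selected at $s_k$ ($D_{\mathrm{KL}}(p_{\Theta|I_k}||p_{\Theta|I_0})+\sum_{i<k}c_i(\xi_i)$ in the terminal formulation, $0$ in the incremental one). $r_k^C(s_k,\xi_k,y_k)$ denotes the stage reward collected if continuation were selected, $\xi_k$ performed and $y_k$ observed ($0$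 in the terminal formulation, $D_{\mathrm{KL}}(p_{\Theta|I_{k+1}}||p_{\Theta|I_k})+c_k(\xi_k)$ in the incremental one). **Objective and value functions.** The expected utility is $$U(\pi,\psi)=\mathbb{E}_{Y_{0:N-1}|\pi,\psi,s_0}\Big[\sum_{k=0}^{N-1}\{r_k(s_k,\xi_k,Y_k)+r_T(s_k)\}+r_T(s_N)\Big].$$ For nonterminal states, the value function is the expected cumulative reward from $s_k$ onward, $$V_k^{\pi,\psi}(s_k)=\mathbb{E}_{Y_{k:N-1}|\pi,\psi,s_k}\Big[\sum_{\ell=k}^{N-1}\{r_\ell(s_\ell,\mu_\ell(s_\ell),Y_\ell)+r_T(s_\ell)\}+r_T(s_N)\Big],\qquad V_N^{\pi,\psi}(s_N)=r_T(s_N),$$ equivalently, for $k<N$, $V_k^{\pi,\psi}(s_k)=r_T^S(s_k)$ if $\varphi_k(s_k)=1$ and $V_k^{\pi,\psi}(s_k)=Q_k^{\pi,\psi}(s_k,\mu_k(s_k))$ if $\varphi_k(s_k)=0$, where the continuation value is $$Q_k^{\pi,\psi}(s_k,\xi_k)=\mathbb{E}_{Y_k|s_k,\xi_k}\big[r_k^C(s_k,\xi_k,Y_k)+V_{k+1}^{\pi,\psi}(\mathcal{F}_k(s_k,\xi_k,Y_k))\big].$$ In particular $U(\pi,\psi)=V_0^{\pi,\psi}(s_0)$. The sets $\mathcal{T}_k$ are determined recursively backward in $k$, since $Q_k^{\pi,\psi^\ast}$ depends only on $\varphi_{k+1}^\ast,\ldots,\varphi_{N-1}^\ast$. Measurability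 and well-definedness (finiteness) of all displayed expectations are understood. *)

theory Defs
  imports "HOL-Probability.Probability"
begin

text \<open>
  A history lists the pairs (design, observation) with the most recent experiment first, so
  the history \<open>I\<close> before experiment \<open>k\<close> has \<open>length I = k\<close> and the next one is \<open>(\<xi>, y) # I\<close>.
\<close>

type_synonym ('d, 'n) history = "((real^'d) \<times> (real^'n)) list"

text \<open>
  The state space is abstract. That a state contains the current belief and all the
  information needed for decisions and rewards is expressed by the last three fields, which
  read off from a state at stage \<open>k\<close> the distribution of \<open>\<Theta>\<close>, the forward map
  (which may depend on the history) and the cost accumulated so far. The locale below requires
  them to agree with what the history determines. The terminal state is not in the state
  space; it is \<open>None\<close> in \<open>'s option\<close>.
\<close>

record ('p, 'd, 'n, 's) design_problem =
  horizon :: nat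
  prior :: "real^'p \<Rightarrow> real"
  designs :: "nat \<Rightarrow> (real^'d) set"
  forward :: "nat \<Rightarrow> real^'p \<Rightarrow> real^'d \<Rightarrow> ('d, 'n) history \<Rightarrow> real^'n"
  noise :: "real^'n \<Rightarrow> real"
  cost :: "nat \<Rightarrow> real^'d \<Rightarrow> real"
  states :: "'s measure"
  init :: 's
  transition :: "nat \<Rightarrow> 's \<Rightarrow> real^'d \<Rightarrow> real^'n \<Rightarrow> 's"
  belief :: "nat \<Rightarrow> 's \<Rightarrow> (real^'p) measure"
  state_forward :: "nat \<Rightarrow> real^'p \<Rightarrow> real^'d \<Rightarrow> 's \<Rightarrow> real^'n"
  state_cost :: "nat \<Rightarrow> 's \<Rightarrow> real"


section \<open>The Bayesian model on histories\<close>

definition likelihood ::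
  "('p::finite, 'd::finite, 'n::finite, 's) design_problem \<Rightarrow> real^'n \<Rightarrow> real^'p \<Rightarrow> real^'d
    \<Rightarrow> ('d, 'n) history \<Rightarrow> real" where
  "likelihood E y \<theta> \<xi> I = noise E (y - forward E (length I) \<theta> \<xi> I)"

fun posterior ::
  "('p::finite, 'd::finite, 'n::finite, 's) design_problem \<Rightarrow> ('d, 'n) history \<Rightarrow> real^'p \<Rightarrow> real" where
  "posterior E [] = prior E"
| "posterior E ((\<xi>, y) # I) = (\<lambda>\<theta>. likelihood E y \<theta> \<xi> I * posterior E I \<theta> /
     (LINT \<theta>'|lborel. likelihood E y \<theta>' \<xi> I * posterior E I \<theta>'))"

definition evidence ::
  "('p::finite, 'd::finite, 'n::finite, 's) design_problem \<Rightarrow> real^'n \<Rightarrow> real^'d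
    \<Rightarrow> ('d, 'n) history \<Rightarrow> real" where
  "evidence E y \<xi> I = (LINT \<theta>|lborel. likelihood E y \<theta> \<xi> I * posterior E I \<theta>)"

text \<open>
  Histories in which Bayes' rule never divides by zero. The Bochner integral \<open>evidence\<close> is
  also 0 when the integral diverges; this too happens only for a null set of observations.
\<close>

fun possible ::
  "('p::finite, 'd::finite, 'n::finite, 's) design_problem \<Rightarrow> ('d, 'n) history \<Rightarrow> bool" where
  "possible E [] \<longleftrightarrow> True"
| "possible E ((\<xi>, y) # I) \<longleftrightarrow> possible E I \<and> \<xi> \<in> designs E (length I) \<and> evidence E y \<xi> I > 0"

fun past_cost ::
  "('p::finite, 'd::finite, 'n::finite, 's) design_problem \<Rightarrow> ('d, 'n) history \<Rightarrow> real" where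
  "past_cost E [] = 0"
| "past_cost E ((\<xi>, y) # I) = past_cost E I + cost E (length I) \<xi>"

fun state_of ::
  "('p::finite, 'd::finite, 'n::finite, 's) design_problem \<Rightarrow> ('d, 'n) history \<Rightarrow> 's" where
  "state_of E [] = init E"
| "state_of E ((\<xi>, y) # I) = transition E (length I) (state_of E I) \<xi> y"


section \<open>Standing assumptions\<close>

definition prior_dist ::
  "('p::finite, 'd::finite, 'n::finite, 's) design_problem \<Rightarrow> (real^'p) measure" where
  "prior_dist E = density lborel (prior E)"

text \<open>
  At states that are not reached by a possible history, the readouts are only required to be
  regular enough for the predictive distribution to make sense.
\<close>

locale bayesian_design =
  fixes E :: "('p::finite, 'd::finite, 'n::finite, 's) design_problem"
  assumes prior_density:
      "prior E \<in> borel_measurable borel" "\<And>\<theta>. 0 \<le> prior E \<theta>"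
      "(\<integral>\<^sup>+\<theta>. prior E \<theta> \<partial>lborel) = 1"
    and noise_density:
      "noise E \<in> borel_measurable borel" "\<And>e. 0 \<le> noise E e"
      "(\<integral>\<^sup>+e. noise E e \<partial>lborel) = 1"
    and cost_nonpos: "\<And>k \<xi>. k < horizon E \<Longrightarrow> \<xi> \<in> designs E k \<Longrightarrow> cost E k \<xi> \<le> 0"
    and init_state: "init E \<in> space (states E)"
    and transition_measurable: "\<And>k. k < horizon E \<Longrightarrow>
      (\<lambda>(s, \<xi>, y). transition E k s \<xi> y)
        \<in> states E \<Otimes>\<^sub>M restrict_space borel (designs E k) \<Otimes>\<^sub>M borel \<rightarrow>\<^sub>M states E"
    and belief_kernel: "\<And>k. k \<le> horizon E \<Longrightarrow> belief E k \<in> states E \<rightarrow>\<^sub>M prob_algebra borel"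
    and state_forward_measurable: "\<And>k. k < horizon E \<Longrightarrow>
      (\<lambda>(\<theta>, \<xi>, s). state_forward E k \<theta> \<xi> s)
        \<in> borel \<Otimes>\<^sub>M restrict_space borel (designs E k) \<Otimes>\<^sub>M states E \<rightarrow>\<^sub>M borel"
    and belief_state_of: "\<And>I. possible E I \<Longrightarrow> length I \<le> horizon E \<Longrightarrow>
      belief E (length I) (state_of E I) = density lborel (posterior E I)"
    and state_forward_state_of: "\<And>I \<theta> \<xi>. possible E I \<Longrightarrow> length I < horizon E \<Longrightarrow>
      \<xi> \<in> designs E (length I) \<Longrightarrow>
      state_forward E (length I) \<theta> \<xi> (state_of E I) = forward E (length I) \<theta> \<xi> I"
    and state_cost_state_of: "\<And>I. possible E I \<Longrightarrow> length I \<le> horizon E \<Longrightarrow>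
      state_cost E (length I) (state_of E I) = past_cost E I"

type_synonym ('d, 's) policy = "nat \<Rightarrow> 's \<Rightarrow> real^'d"
type_synonym 's stopping = "nat \<Rightarrow> 's \<Rightarrow> nat"

definition design_policy ::
  "('p::finite, 'd::finite, 'n::finite, 's) design_problem \<Rightarrow> ('d, 's) policy \<Rightarrow> bool" where
  "design_policy E \<mu> \<longleftrightarrow>
    (\<forall>k<horizon E. \<mu> k \<in> states E \<rightarrow>\<^sub>M restrict_space borel (designs E k))"

definition stopping_policy ::
  "('p::finite, 'd::finite, 'n::finite, 's) design_problem \<Rightarrow> 's stopping \<Rightarrow> bool" where
  "stopping_policy E \<phi> \<longleftrightarrow> (\<forall>k<horizon E. \<phi> k \<in> states E \<rightarrow>\<^sub>M count_space {0, 1})"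


section \<open>Controlled dynamics\<close>

definition predictive ::
  "('p::finite, 'd::finite, 'n::finite, 's) design_problem \<Rightarrow> nat \<Rightarrow> 's \<Rightarrow> real^'d
    \<Rightarrow> (real^'n) measure" where
  "predictive E k s \<xi> =
    density lborel (\<lambda>y. LINT \<theta>|belief E k s. noise E (y - state_forward E k \<theta> \<xi> s))"

definition succ_state ::
  "('p::finite, 'd::finite, 'n::finite, 's) design_problem \<Rightarrow> ('d, 's) policy \<Rightarrow> 's stopping
    \<Rightarrow> nat \<Rightarrow> 's option \<Rightarrow> real^'n \<Rightarrow> 's option" where
  "succ_state E \<mu> \<phi> k x y = (case x of None \<Rightarrow> None
    | Some s \<Rightarrow> if \<phi> k s = 0 then Some (transition E k s (\<mu> k s) y) else None)"

text \<open>
  Once experimentation has stopped no observation is made. To keep a fixed index set for the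
  observations, the missing ones are set to 0; neither states nor rewards depend on them.
\<close>

definition obs_kernel ::
  "('p::finite, 'd::finite, 'n::finite, 's) design_problem \<Rightarrow> ('d, 's) policy \<Rightarrow> 's stopping
    \<Rightarrow> nat \<Rightarrow> 's option \<Rightarrow> (real^'n) measure" where
  "obs_kernel E \<mu> \<phi> k x = (case x of None \<Rightarrow> return borel 0
    | Some s \<Rightarrow> if \<phi> k s = 0 then predictive E k s (\<mu> k s) else return borel 0)"

text \<open>
  \<open>obs_law E \<mu> \<phi> m k x\<close> is the joint law of the \<open>m\<close> observations at stages
  \<open>k, \<dots>, k + m - 1\<close>, given the state \<open>x\<close> at stage \<open>k\<close>.
\<close>

primrec obs_law ::
  "('p::finite, 'd::finite, 'n::finite, 's) design_problem \<Rightarrow> ('d, 's) policy \<Rightarrow> 's stopping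
    \<Rightarrow> nat \<Rightarrow> nat \<Rightarrow> 's option \<Rightarrow> (nat \<Rightarrow> real^'n) measure" where
  "obs_law E \<mu> \<phi> 0 k x = return (Pi\<^sub>M {} (\<lambda>_. borel)) (\<lambda>_. undefined)"
| "obs_law E \<mu> \<phi> (Suc m) k x =
     obs_kernel E \<mu> \<phi> k x \<bind> (\<lambda>y.
       distr (obs_law E \<mu> \<phi> m (Suc k) (succ_state E \<mu> \<phi> k x y))
         (Pi\<^sub>M {k..<k + Suc m} (\<lambda>_. borel)) (\<lambda>\<omega>. fun_upd \<omega> k y))"

text \<open>\<open>state_at E \<mu> \<phi> k x \<omega> l\<close> is the state at stage \<open>l \<ge> k\<close> when the state at stage \<open>k\<close> is
  \<open>x\<close> and the observations are \<open>\<omega> k, \<omega> (k + 1), \<dots>\<close>.\<close>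

primrec state_at ::
  "('p::finite, 'd::finite, 'n::finite, 's) design_problem \<Rightarrow> ('d, 's) policy \<Rightarrow> 's stopping
    \<Rightarrow> nat \<Rightarrow> 's option \<Rightarrow> (nat \<Rightarrow> real^'n) \<Rightarrow> nat \<Rightarrow> 's option" where
  "state_at E \<mu> \<phi> k x \<omega> 0 = x"
| "state_at E \<mu> \<phi> k x \<omega> (Suc l) =
     (if k \<le> l then succ_state E \<mu> \<phi> l (state_at E \<mu> \<phi> k x \<omega> l) (\<omega> l) else x)"


section \<open>Rewards\<close>

text \<open>The library's \<open>KL_divergence b Q P\<close> is the divergence of \<open>P\<close> from \<open>Q\<close>, that is
  \<open>D(P || Q)\<close>, and is meaningful only under \<open>KL_finite P Q\<close>.\<close>

definition KL :: "'a measure \<Rightarrow> 'a measure \<Rightarrow> real" where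
  "KL P Q = KL_divergence (exp 1) Q P"

definition KL_finite :: "'a measure \<Rightarrow> 'a measure \<Rightarrow> bool" where
  "KL_finite P Q \<longleftrightarrow> absolutely_continuous Q P \<and> integrable P (entropy_density (exp 1) Q P)"

datatype formulation = Terminal | Incremental

fun stop_reward ::
  "('p::finite, 'd::finite, 'n::finite, 's) design_problem \<Rightarrow> formulation \<Rightarrow> nat \<Rightarrow> 's \<Rightarrow> real" where
  "stop_reward E Terminal k s = KL (belief E k s) (prior_dist E) + state_cost E k s"
| "stop_reward E Incremental k s = 0"

fun cont_reward ::
  "('p::finite, 'd::finite, 'n::finite, 's) design_problem \<Rightarrow> formulation \<Rightarrow> nat \<Rightarrow> 's \<Rightarrow> real^'d
    \<Rightarrow> real^'n \<Rightarrow> real" where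
  "cont_reward E Terminal k s \<xi> y = 0"
| "cont_reward E Incremental k s \<xi> y =
     KL (belief E (Suc k) (transition E k s \<xi> y)) (belief E k s) + cost E k \<xi>"

definition terminal_reward ::
  "('p::finite, 'd::finite, 'n::finite, 's) design_problem \<Rightarrow> formulation \<Rightarrow> 's stopping
    \<Rightarrow> nat \<Rightarrow> 's option \<Rightarrow> real" where
  "terminal_reward E fm \<phi> k x = (case x of None \<Rightarrow> 0
    | Some s \<Rightarrow> if k < horizon E \<and> \<phi> k s = 1 \<or> k = horizon E then stop_reward E fm k s else 0)"

definition stage_reward ::
  "('p::finite, 'd::finite, 'n::finite, 's) design_problem \<Rightarrow> formulation \<Rightarrow> ('d, 's) policy
    \<Rightarrow> 's stopping \<Rightarrow> nat \<Rightarrow> 's option \<Rightarrow> real^'n \<Rightarrow> real" where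
  "stage_reward E fm \<mu> \<phi> k x y = (case x of None \<Rightarrow> 0
    | Some s \<Rightarrow> if \<phi> k s = 0 then cont_reward E fm k s (\<mu> k s) y else 0)"

definition total_reward ::
  "('p::finite, 'd::finite, 'n::finite, 's) design_problem \<Rightarrow> formulation \<Rightarrow> ('d, 's) policy
    \<Rightarrow> 's stopping \<Rightarrow> nat \<Rightarrow> 's option \<Rightarrow> (nat \<Rightarrow> real^'n) \<Rightarrow> real" where
  "total_reward E fm \<mu> \<phi> k x \<omega> =
    (\<Sum>l = k..<horizon E. stage_reward E fm \<mu> \<phi> l (state_at E \<mu> \<phi> k x \<omega> l) (\<omega> l)
       + terminal_reward E fm \<phi> l (state_at E \<mu> \<phi> k x \<omega> l))
    + terminal_reward E fm \<phi> (horizon E) (state_at E \<mu> \<phi> k x \<omega> (horizon E))"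


section \<open>Expected utility and value functions\<close>

definition expected_utility ::
  "('p::finite, 'd::finite, 'n::finite, 's) design_problem \<Rightarrow> formulation \<Rightarrow> ('d, 's) policy
    \<Rightarrow> 's stopping \<Rightarrow> real" where
  "expected_utility E fm \<mu> \<phi> =
    (LINT \<omega>|obs_law E \<mu> \<phi> (horizon E) 0 (Some (init E)).
       total_reward E fm \<mu> \<phi> 0 (Some (init E)) \<omega>)"

definition value_fun ::
  "('p::finite, 'd::finite, 'n::finite, 's) design_problem \<Rightarrow> formulation \<Rightarrow> ('d, 's) policy
    \<Rightarrow> 's stopping \<Rightarrow> nat \<Rightarrow> 's \<Rightarrow> real" where
  "value_fun E fm \<mu> \<phi> k s =
    (LINT \<omega>|obs_law E \<mu> \<phi> (horizon E - k) k (Some s). total_reward E fm \<mu> \<phi> k (Some s) \<omega>)"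

definition cont_value ::
  "('p::finite, 'd::finite, 'n::finite, 's) design_problem \<Rightarrow> formulation \<Rightarrow> ('d, 's) policy
    \<Rightarrow> 's stopping \<Rightarrow> nat \<Rightarrow> 's \<Rightarrow> real^'d \<Rightarrow> real" where
  "cont_value E fm \<mu> \<phi> k s \<xi> =
    (LINT y|predictive E k s \<xi>.
       cont_reward E fm k s \<xi> y + value_fun E fm \<mu> \<phi> (Suc k) (transition E k s \<xi> y))"

definition stopping_set ::
  "('p::finite, 'd::finite, 'n::finite, 's) design_problem \<Rightarrow> formulation \<Rightarrow> ('d, 's) policy
    \<Rightarrow> 's stopping \<Rightarrow> nat \<Rightarrow> 's set" where
  "stopping_set E fm \<mu> \<phi> k =
    {s \<in> space (states E). stop_reward E fm k s \<ge> cont_value E fm \<mu> \<phi> k s (\<mu> k s)}"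

text \<open>
  Measurability of the rewards, finiteness of the divergences in the formulation \<open>fm\<close>, and
  finiteness of the expectations defining the value functions, for the design policy \<open>\<mu>\<close> and
  all stopping policies. Finiteness of the continuation values follows.
\<close>

definition well_defined ::
  "('p::finite, 'd::finite, 'n::finite, 's) design_problem \<Rightarrow> formulation \<Rightarrow> ('d, 's) policy \<Rightarrow> bool" where
  "well_defined E fm \<mu> \<longleftrightarrow>
    (\<forall>k\<le>horizon E. stop_reward E fm k \<in> borel_measurable (states E)) \<and>
    (\<forall>k<horizon E. (\<lambda>(s, y). cont_reward E fm k s (\<mu> k s) y)
        \<in> borel_measurable (states E \<Otimes>\<^sub>M borel)) \<and>
    (fm = Terminal \<longrightarrow>
      (\<forall>k\<le>horizon E. \<forall>s\<in>space (states E). KL_finite (belief E k s) (prior_dist E))) \<and>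
    (fm = Incremental \<longrightarrow>
      (\<forall>k<horizon E. \<forall>s\<in>space (states E). AE y in predictive E k s (\<mu> k s).
        KL_finite (belief E (Suc k) (transition E k s (\<mu> k s) y)) (belief E k s))) \<and>
    (\<forall>\<phi>. stopping_policy E \<phi> \<longrightarrow> (\<forall>k\<le>horizon E. \<forall>s\<in>space (states E).
        integrable (obs_law E \<mu> \<phi> (horizon E - k) k (Some s))
          (total_reward E fm \<mu> \<phi> k (Some s))))"

end

theory Submission
  imports Defs
begin

text \<open>
  The joint law of the observations is an iterated bind of probability kernels, so integrating
  the total reward one stage at a time gives the Bellman equation: the value is the terminal
  reward where the policy stops and the continuation value where it continues. As continuation
  values depend only on later stages, the greedy policy can be built backward from the horizon;
  its value at each stage is the maximum of the two alternatives, hence by backward induction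
  dominates the value of every other stopping policy at every state.
\<close>

section \<open>Integration against kernels\<close>

text \<open>The integrand varies with the parameter. Pushing \<open>L x\<close> forward along
  \<open>y \<mapsto> (x, y)\<close> yields a kernel on the product space against which one fixed
  integrand is integrated.\<close>

lemma integral_measurable_subprob_algebra2:
  fixes f :: "'a \<Rightarrow> 'b \<Rightarrow> real"
  assumes f[measurable]: "(\<lambda>(x, y). f x y) \<in> borel_measurable (M \<Otimes>\<^sub>M N)"
    and L[measurable]: "L \<in> M \<rightarrow>\<^sub>M subprob_algebra N"
  shows "(\<lambda>x. LINT y|L x. f x y) \<in> borel_measurable M"
proof -
  note integral_measurable_subprob_algebra[measurable]
  note measurable_distr2[measurable]
  have "(\<lambda>x. integral\<^sup>L (distr (L x) (M \<Otimes>\<^sub>M N) (\<lambda>y. (x, y))) (\<lambda>(x, y). f x y)) \<in> borel_measurable M"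
    by measurable
  then show ?thesis
    by (rule measurable_cong[THEN iffD1, rotated]) (simp add: integral_distr)
qed

text \<open>Tonelli for \<open>bind\<close> gives both claims for nonnegative integrands; a signed
  one is split into positive and negative parts. With \<open>f_inner\<close> at every
  \<open>x\<close>, each inner Bochner integral is a genuine one and never the default 0.\<close>

lemma
  fixes f :: "'b \<Rightarrow> real"
  assumes N: "N \<in> M \<rightarrow>\<^sub>M subprob_algebra B" and f: "integrable (M \<bind> N) f"
    and f_meas: "f \<in> borel_measurable B"
    and f_inner: "\<And>x. x \<in> space M \<Longrightarrow> integrable (N x) f"
  shows integrable_integral_bind: "integrable M (\<lambda>x. LINT y|N x. f y)"
    and integral_bind_integrable: "(LINT y|(M \<bind> N). f y) = (LINT x|M. LINT y|N x. f y)"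
proof -
  have meas: "(\<lambda>x. LINT y|N x. g y) \<in> borel_measurable M"
    if "g \<in> borel_measurable B" for g :: "'b \<Rightarrow> real"
    by (rule measurable_compose[OF N integral_measurable_subprob_algebra[OF that]])
  have *: "integrable M (\<lambda>x. LINT y|N x. g y) \<and> (LINT y|(M \<bind> N). g y) = (LINT x|M. LINT y|N x. g y)"
    if g: "integrable (M \<bind> N) g" and gB: "g \<in> borel_measurable B"
      and g_inner: "\<And>x. x \<in> space M \<Longrightarrow> integrable (N x) g" and g_pos: "\<And>y. 0 \<le> g y"
    for g :: "'b \<Rightarrow> real"
  proof -
    have "ennreal (LINT y|(M \<bind> N). g y) = (\<integral>\<^sup>+y. g y \<partial>(M \<bind> N))"
      using g g_pos by (subst nn_integral_eq_integral) auto
    also have "\<dots> = (\<integral>\<^sup>+x. \<integral>\<^sup>+y. g y \<partial>N x \<partial>M)"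
      using gB by (intro nn_integral_bind[OF _ N]) simp
    also have "\<dots> = (\<integral>\<^sup>+x. ennreal (LINT y|N x. g y) \<partial>M)"
      using g_inner g_pos by (intro nn_integral_cong nn_integral_eq_integral) auto
    finally have eq: "(\<integral>\<^sup>+x. ennreal (LINT y|N x. g y) \<partial>M) = ennreal (LINT y|(M \<bind> N). g y)" ..
    \<comment> \<open>A finite nonnegative integral yields integrability and the value of the
      Bochner integral at once.\<close>
    show ?thesis
      using nn_integral_eq_integrable[THEN iffD1, OF _ _ _ eq] meas[OF gB] g_pos by auto
  qed
  let ?p = "\<lambda>y. max 0 (f y)" and ?n = "\<lambda>y. max 0 (- f y)"
  have p: "integrable M (\<lambda>x. LINT y|N x. ?p y)" "(LINT y|(M \<bind> N). ?p y) = (LINT x|M. LINT y|N x. ?p y)"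
    using *[of ?p] f f_meas f_inner by auto
  have n: "integrable M (\<lambda>x. LINT y|N x. ?n y)" "(LINT y|(M \<bind> N). ?n y) = (LINT x|M. LINT y|N x. ?n y)"
    using *[of ?n] f f_meas f_inner by auto
  have split: "integral\<^sup>L Q f = (LINT y|Q. ?p y) - (LINT y|Q. ?n y)" if "integrable Q f" for Q
  proof -
    have "integral\<^sup>L Q f = (LINT y|Q. ?p y - ?n y)"
      by (intro Bochner_Integration.integral_cong) auto
    then show ?thesis using that by simp
  qed
  have inner: "(LINT y|N x. f y) = (LINT y|N x. ?p y) - (LINT y|N x. ?n y)" if "x \<in> space M" for x
    using split f_inner that by blast
  show "integrable M (\<lambda>x. LINT y|N x. f y)"
    by (subst Bochner_Integration.integrable_cong[OF refl inner]) (use p n in auto)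
  show "(LINT y|(M \<bind> N). f y) = (LINT x|M. LINT y|N x. f y)"
    using p n by (simp add: split[OF f] inner cong: Bochner_Integration.integral_cong)
qed

text \<open>Translation invariance: noise centred at the forward map keeps total mass 1.\<close>

lemma nn_integral_lborel_shift:
  fixes f :: "'a::euclidean_space \<Rightarrow> ennreal"
  assumes [measurable]: "f \<in> borel_measurable borel"
  shows "(\<integral>\<^sup>+y. f (y - c) \<partial>lborel) = (\<integral>\<^sup>+y. f y \<partial>lborel)"
proof -
  have "(\<integral>\<^sup>+y. f (y - c) \<partial>lborel) = (\<integral>\<^sup>+y. f (y - c) \<partial>distr lborel borel ((+) c))"
    by (simp add: lborel_distr_plus)
  also have "\<dots> = (\<integral>\<^sup>+y. f y \<partial>lborel)"
    by (subst nn_integral_distr) auto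
  finally show ?thesis .
qed

text \<open>With the design policy fixed, only the decision to stop remains free: the problem
  becomes optimal stopping of a time-inhomogeneous Markov chain, treated uniformly for both reward
  formulations.\<close>

locale sequential_design = bayesian_design E
  for E :: "('p::finite, 'd::finite, 'n::finite, 's) design_problem" +
  fixes fm :: formulation and \<mu> :: "('d, 's) policy"
  assumes design: "design_policy E \<mu>" and well_def: "well_defined E fm \<mu>"
begin

abbreviation "\<S> \<equiv> states E"
abbreviation "H \<equiv> horizon E"

section \<open>The controlled process as a Markov kernel\<close>

lemma design_measurable:
  assumes "k < H"
  shows "\<mu> k \<in> \<S> \<rightarrow>\<^sub>M restrict_space borel (designs E k)"
  using design assms by (simp add: design_policy_def)

lemma next_state_measurable:
  assumes "k < H"
  shows "(\<lambda>(s, y). transition E k s (\<mu> k s) y) \<in> \<S> \<Otimes>\<^sub>M borel \<rightarrow>\<^sub>M \<S>"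
proof -
  note [measurable] = design_measurable[OF assms]
  have "(\<lambda>(s, y). (s, \<mu> k s, y))
      \<in> \<S> \<Otimes>\<^sub>M borel \<rightarrow>\<^sub>M \<S> \<Otimes>\<^sub>M restrict_space borel (designs E k) \<Otimes>\<^sub>M borel"
    by measurable
  from measurable_compose[OF this transition_measurable[OF assms]]
  show ?thesis by (simp add: case_prod_unfold)
qed

lemma next_state_measurable1:
  assumes "k < H" "s \<in> space \<S>"
  shows "transition E k s (\<mu> k s) \<in> borel \<rightarrow>\<^sub>M \<S>"
  using measurable_compose[OF measurable_Pair1'[OF assms(2)] next_state_measurable[OF assms(1)]]
  by simp

lemma next_state_in_states:
  assumes "k < H" "s \<in> space \<S>"
  shows "transition E k s (\<mu> k s) y \<in> space \<S>"
  using measurable_space[OF next_state_measurable1[OF assms]] by simp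

text \<open>The nesting \<open>((s, y), \<theta>)\<close> makes \<open>(s, y)\<close> the parameter
  and \<open>\<theta>\<close> the variable integrated against the belief, the shape required by
  \<open>integral_measurable_subprob_algebra2\<close>.\<close>

lemma residual_measurable:
  assumes "k < H"
  shows "(\<lambda>x. noise E (snd (fst x) - state_forward E k (snd x) (\<mu> k (fst (fst x))) (fst (fst x))))
    \<in> borel_measurable ((\<S> \<Otimes>\<^sub>M borel) \<Otimes>\<^sub>M borel)"
proof -
  note [measurable] = design_measurable[OF assms] noise_density(1)
  have "(\<lambda>x. (snd x, \<mu> k (fst (fst x)), fst (fst x)))
      \<in> (\<S> \<Otimes>\<^sub>M (borel :: (real^'n) measure)) \<Otimes>\<^sub>M borel \<rightarrow>\<^sub>M borel \<Otimes>\<^sub>M restrict_space borel (designs E k) \<Otimes>\<^sub>M \<S>"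
    by measurable
  from measurable_compose[OF this state_forward_measurable[OF assms]]
  have [measurable]: "(\<lambda>x. state_forward E k (snd x) (\<mu> k (fst (fst x))) (fst (fst x)))
      \<in> (\<S> \<Otimes>\<^sub>M (borel :: (real^'n) measure)) \<Otimes>\<^sub>M borel \<rightarrow>\<^sub>M borel"
    by (simp add: case_prod_unfold)
  show ?thesis by measurable
qed

lemma predictive_density_measurable:
  assumes "k < H"
  shows "(\<lambda>(s, y). LINT \<theta>|belief E k s. noise E (y - state_forward E k \<theta> (\<mu> k s) s))
    \<in> borel_measurable (\<S> \<Otimes>\<^sub>M borel)"
proof -
  have "(\<lambda>x :: 's \<times> (real^'n). belief E k (fst x)) \<in> \<S> \<Otimes>\<^sub>M borel \<rightarrow>\<^sub>M subprob_algebra borel"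
    using assms by (intro measurable_prob_algebraD measurable_compose[OF measurable_fst belief_kernel]) simp
  from integral_measurable_subprob_algebra2[OF _ this,
      of "\<lambda>x \<theta>. noise E (snd x - state_forward E k \<theta> (\<mu> k (fst x)) (fst x))"]
  show ?thesis
    using residual_measurable[OF assms] by (simp add: case_prod_unfold)
qed

text \<open>By Tonelli, \<open>y\<close> may be integrated first: for each \<open>\<theta>\<close>
  the shifted noise has mass 1, and the belief is itself a probability measure.\<close>

lemma prob_space_predictive:
  assumes k: "k < H" and s: "s \<in> space \<S>"
  shows "prob_space (predictive E k s (\<mu> k s))"
proof -
  let ?B = "belief E k s" and ?g = "\<lambda>y \<theta>. noise E (y - state_forward E k \<theta> (\<mu> k s) s)"
  have B: "prob_space ?B" and sets_B[measurable_cong]: "sets ?B = sets borel"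
    using measurable_space[OF belief_kernel s] k by (auto simp: space_prob_algebra)
  interpret B: prob_space ?B by (rule B)
  interpret pair_sigma_finite ?B lborel ..
  have "(\<lambda>(y, \<theta>). ((s, y), \<theta>)) \<in> borel \<Otimes>\<^sub>M borel \<rightarrow>\<^sub>M (\<S> \<Otimes>\<^sub>M borel) \<Otimes>\<^sub>M borel"
    using s by measurable
  from measurable_compose[OF this residual_measurable[OF k]]
  have g[measurable]: "(\<lambda>(y, \<theta>). ?g y \<theta>) \<in> borel_measurable (borel \<Otimes>\<^sub>M borel)"
    by (simp add: case_prod_unfold)
  have "(\<integral>\<^sup>+y. \<integral>\<^sup>+\<theta>. ennreal (?g y \<theta>) \<partial>?B \<partial>lborel) = (\<integral>\<^sup>+\<theta>. \<integral>\<^sup>+y. ennreal (?g y \<theta>) \<partial>lborel \<partial>?B)"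
    by (rule Fubini') measurable
  also have "\<dots> = (\<integral>\<^sup>+\<theta>. 1 \<partial>?B)"
    using noise_density by (intro nn_integral_cong)
      (subst nn_integral_lborel_shift[where f="\<lambda>e. ennreal (noise E e)"], auto)
  finally have mass: "(\<integral>\<^sup>+y. \<integral>\<^sup>+\<theta>. ennreal (?g y \<theta>) \<partial>?B \<partial>lborel) = 1"
    by (simp add: B.emeasure_space_1)
  \<comment> \<open>The density in \<open>predictive\<close> is a Bochner integral, which would be 0
    where the nonnegative integral diverges. The finite total mass confines this to a null
    set.\<close>
  have "AE y in lborel. (\<integral>\<^sup>+\<theta>. ennreal (?g y \<theta>) \<partial>?B) \<noteq> \<infinity>"
    by (rule nn_integral_PInf_AE) (use mass in simp_all)
  then have "AE y in lborel. ennreal (LINT \<theta>|?B. ?g y \<theta>) = (\<integral>\<^sup>+\<theta>. ennreal (?g y \<theta>) \<partial>?B)"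
  proof eventually_elim
    case (elim y)
    have "(\<lambda>\<theta>. ?g y \<theta>) \<in> borel_measurable ?B" by measurable
    then have "integrable ?B (?g y)"
      using elim noise_density(2) by (intro integrableI_nonneg) (auto simp: less_top)
    then show ?case
      using noise_density(2) by (intro nn_integral_eq_integral[symmetric]) auto
  qed
  then have "(\<integral>\<^sup>+y. ennreal (LINT \<theta>|?B. ?g y \<theta>) \<partial>lborel) = 1"
    using mass by (subst nn_integral_cong_AE) auto
  then show ?thesis
    by (intro prob_spaceI) (simp add: predictive_def emeasure_density)
qed

lemma sets_predictive [simp]: "sets (predictive E k s \<xi>) = sets borel"
  by (simp add: predictive_def)

lemma space_predictive [simp]: "space (predictive E k s \<xi>) = UNIV"
  by (simp add: predictive_def)

lemma predictive_kernel:
  assumes k: "k < H"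
  shows "(\<lambda>s. predictive E k s (\<mu> k s)) \<in> \<S> \<rightarrow>\<^sub>M prob_algebra borel"
proof (rule measurable_prob_algebraI[OF prob_space_predictive[OF k]])
  note [measurable] = predictive_density_measurable[OF k]
  show "(\<lambda>s. predictive E k s (\<mu> k s)) \<in> \<S> \<rightarrow>\<^sub>M subprob_algebra borel"
  proof (rule measurable_subprob_algebra)
    fix A :: "(real^'n) set" assume [measurable]: "A \<in> sets borel"
    have "(\<lambda>s. \<integral>\<^sup>+y. ennreal (LINT \<theta>|belief E k s. noise E (y - state_forward E k \<theta> (\<mu> k s) s)) *
        indicator A y \<partial>lborel) \<in> borel_measurable \<S>"
      by measurable
    then show "(\<lambda>s. emeasure (predictive E k s (\<mu> k s)) A) \<in> borel_measurable \<S>"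
    proof (rule measurable_cong[THEN iffD1, rotated], goal_cases)
      case (1 s)
      have [measurable]: "(\<lambda>y. LINT \<theta>|belief E k s. noise E (y - state_forward E k \<theta> (\<mu> k s) s))
          \<in> borel_measurable borel"
        using measurable_compose[OF measurable_Pair1'[OF 1] predictive_density_measurable[OF k]]
        by simp
      show ?case by (simp add: predictive_def emeasure_density)
    qed
  qed (auto intro: prob_space_imp_subprob_space prob_space_predictive[OF k])
qed

section \<open>Joint law of the observations\<close>

abbreviation "paths k m \<equiv> Pi\<^sub>M {k..<k + m} (\<lambda>_. borel :: (real^'n) measure)"

lemma path_extend_measurable:
  "(\<lambda>(\<omega>, y). fun_upd \<omega> k y) \<in> paths (Suc k) m \<Otimes>\<^sub>M borel \<rightarrow>\<^sub>M paths k (Suc m)"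
proof -
  have "insert k {Suc k..<Suc k + m} = {k..<k + Suc m}" by auto
  then show ?thesis
    using measurable_add_dim[of k "{Suc k..<Suc k + m}" "\<lambda>_. borel :: (real^'n) measure"] by simp
qed

text \<open>The terminal state \<open>None\<close> lies outside \<open>\<S>\<close>, so it needs its
  own induction; the law found here supplies the stopped branch of
  \<open>obs_law_kernel\<close>.\<close>

lemma obs_law_None: "obs_law E \<mu> \<phi> m k None \<in> space (prob_algebra (paths k m))"
proof (induction m arbitrary: k)
  case 0
  then show ?case by (auto simp: space_prob_algebra space_PiM intro!: prob_space_return)
next
  case (Suc m)
  have "(\<lambda>y. distr (obs_law E \<mu> \<phi> m (Suc k) None) (paths k (Suc m)) (\<lambda>\<omega>. fun_upd \<omega> k y))
      \<in> borel \<rightarrow>\<^sub>M prob_algebra (paths k (Suc m))"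
  proof (rule measurable_distr_prob_space2[where M="paths (Suc k) m"])
    show "(\<lambda>y. obs_law E \<mu> \<phi> m (Suc k) None) \<in> borel \<rightarrow>\<^sub>M prob_algebra (paths (Suc k) m)"
      by (rule measurable_const[OF Suc.IH])
    show "(\<lambda>(y, \<omega>). fun_upd \<omega> k y) \<in> borel \<Otimes>\<^sub>M paths (Suc k) m \<rightarrow>\<^sub>M paths k (Suc m)"
      using measurable_compose[OF measurable_pair_swap' path_extend_measurable[of k m]]
      by (simp add: case_prod_unfold)
  qed
  moreover have "return borel 0 \<in> space (prob_algebra (borel :: (real^'n) measure))"
    by (auto simp: space_prob_algebra intro!: prob_space_return)
  ultimately show ?case
    by (auto simp: space_prob_algebra obs_kernel_def succ_state_def
        intro: prob_space_bind' sets_bind'[simplified space_prob_algebra])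
qed

lemma stopping_policy_in:
  "\<lbrakk>stopping_policy E \<phi>; k < H; s \<in> space \<S>\<rbrakk> \<Longrightarrow> \<phi> k s = 0 \<or> \<phi> k s = 1"
  using measurable_space[of "\<phi> k" \<S> "count_space {0, 1}" s] by (auto simp: stopping_policy_def)

lemma continue_measurable:
  assumes "stopping_policy E \<phi>" "k < H"
  shows "{s \<in> space \<S>. \<phi> k s = 0} \<in> sets \<S>"
proof -
  have "\<phi> k -` {0} \<inter> space \<S> \<in> sets \<S>"
    using assms by (intro measurable_sets[of _ _ "count_space {0, 1}"]) (auto simp: stopping_policy_def)
  also have "\<phi> k -` {0} \<inter> space \<S> = {s \<in> space \<S>. \<phi> k s = 0}" by auto
  finally show ?thesis .
qed

text \<open>Continuing composes the predictive kernel with the kernel of the remaining path,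
  stopping gives a fixed law, and the two are glued along the measurable set where
  \<open>\<phi> k\<close> continues. The bound on \<open>k + m\<close> keeps every transition before
  the horizon.\<close>

lemma obs_law_kernel:
  assumes \<phi>: "stopping_policy E \<phi>" and "k + m \<le> H"
  shows "(\<lambda>s. obs_law E \<mu> \<phi> m k (Some s)) \<in> \<S> \<rightarrow>\<^sub>M prob_algebra (paths k m)"
  using \<open>k + m \<le> H\<close>
proof (induction m arbitrary: k)
  case 0
  then show ?case
    by (auto simp: space_prob_algebra space_PiM intro!: prob_space_return measurable_const)
next
  case (Suc m)
  have k: "k < H" using Suc.prems by simp
  let ?ext = "\<lambda>Q y. distr Q (paths k (Suc m)) (\<lambda>\<omega>. fun_upd \<omega> k y)"
  have [measurable]: "(\<lambda>x. obs_law E \<mu> \<phi> m (Suc k) (Some (transition E k (fst x) (\<mu> k (fst x)) (snd x))))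
      \<in> \<S> \<Otimes>\<^sub>M borel \<rightarrow>\<^sub>M prob_algebra (paths (Suc k) m)"
    using measurable_compose[OF next_state_measurable[OF k] Suc.IH[of "Suc k"]] Suc.prems
    by (simp add: case_prod_unfold)
  have [measurable]: "(\<lambda>(x, \<omega>). fun_upd \<omega> k (snd x))
      \<in> (\<S> \<Otimes>\<^sub>M borel) \<Otimes>\<^sub>M paths (Suc k) m \<rightarrow>\<^sub>M paths k (Suc m)"
    using measurable_compose[OF _ path_extend_measurable[of k m],
        of "\<lambda>x. (snd x, snd (fst x))" "(\<S> \<Otimes>\<^sub>M borel) \<Otimes>\<^sub>M paths (Suc k) m"]
    by (simp add: case_prod_unfold)
  have cont: "(\<lambda>s. predictive E k s (\<mu> k s) \<bind>
      (\<lambda>y. ?ext (obs_law E \<mu> \<phi> m (Suc k) (Some (transition E k s (\<mu> k s) y))) y))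
      \<in> \<S> \<rightarrow>\<^sub>M prob_algebra (paths k (Suc m))"
    unfolding case_prod_unfold
    by (rule measurable_bind_prob_space2[OF predictive_kernel[OF k]])
      (simp only: case_prod_unfold, rule measurable_distr_prob_space2[where M="paths (Suc k) m"], measurable)
  \<comment> \<open>Stopping records the observation 0 and moves to \<open>None\<close>, which is
    exactly what one recursion step of \<open>obs_law\<close> does at \<open>None\<close>.\<close>
  have stop: "return borel 0 \<bind> ?ext (obs_law E \<mu> \<phi> m (Suc k) None)
      \<in> space (prob_algebra (paths k (Suc m)))"
    using obs_law_None[of \<phi> "Suc m" k] by (simp add: obs_kernel_def succ_state_def)
  have "(\<lambda>s. if \<phi> k s = 0 then predictive E k s (\<mu> k s) \<bind>
        (\<lambda>y. ?ext (obs_law E \<mu> \<phi> m (Suc k) (Some (transition E k s (\<mu> k s) y))) y)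
      else return borel 0 \<bind> ?ext (obs_law E \<mu> \<phi> m (Suc k) None))
      \<in> \<S> \<rightarrow>\<^sub>M prob_algebra (paths k (Suc m))"
    by (rule measurable_If[OF cont measurable_const[OF stop] continue_measurable[OF \<phi> k]])
  then show ?case
    by (rule measurable_cong[THEN iffD1, rotated]) (simp add: obs_kernel_def succ_state_def)
qed

lemma
  assumes "stopping_policy E \<phi>" "k + m \<le> H" "s \<in> space \<S>"
  shows prob_space_obs_law: "prob_space (obs_law E \<mu> \<phi> m k (Some s))"
    and sets_obs_law: "sets (obs_law E \<mu> \<phi> m k (Some s)) = sets (paths k m)"
  using measurable_space[OF obs_law_kernel[OF assms(1,2)] assms(3)] by (auto simp: space_prob_algebra)


section \<open>The Bellman equation for a stopping policy\<close>

lemma state_at_start: "l \<le> k \<Longrightarrow> state_at E \<mu> \<phi> k x \<omega> l = x"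
  by (cases l) auto

text \<open>\<open>state_at\<close> recurses on the last stage whereas \<open>obs_law\<close> splits
  off the first observation; this brings the two into line.\<close>

lemma state_at_Suc_start:
  "Suc k \<le> l \<Longrightarrow> state_at E \<mu> \<phi> k x \<omega> l =
    state_at E \<mu> \<phi> (Suc k) (succ_state E \<mu> \<phi> k x (\<omega> k)) \<omega> l"
proof (induction l)
  case (Suc l)
  then show ?case by (cases "k = l") (auto simp: state_at_start)
qed simp

lemma state_at_cong:
  "(\<And>j. k \<le> j \<Longrightarrow> \<omega> j = \<omega>' j) \<Longrightarrow> state_at E \<mu> \<phi> k x \<omega> l = state_at E \<mu> \<phi> k x \<omega>' l"
  by (induction l) auto

lemma state_at_None: "state_at E \<mu> \<phi> k None \<omega> l = None"
  by (induction l) (auto simp: succ_state_def)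

lemma total_reward_None: "total_reward E fm \<mu> \<phi> k None \<omega> = 0"
  by (simp add: total_reward_def state_at_None stage_reward_def terminal_reward_def)

lemma total_reward_step:
  assumes "k < H"
  shows "total_reward E fm \<mu> \<phi> k x \<omega> = stage_reward E fm \<mu> \<phi> k x (\<omega> k)
    + terminal_reward E fm \<phi> k x + total_reward E fm \<mu> \<phi> (Suc k) (succ_state E \<mu> \<phi> k x (\<omega> k)) \<omega>"
  using assms
  by (simp add: total_reward_def sum.atLeast_Suc_lessThan state_at_start state_at_Suc_start)

text \<open>States and rewards from stage \<open>Suc k\<close> on read only later coordinates, so
  the coordinate that \<open>obs_law\<close> overwrites is invisible to them.\<close>

lemma total_reward_fun_upd:
  "total_reward E fm \<mu> \<phi> (Suc k) x (fun_upd \<omega> k y) = total_reward E fm \<mu> \<phi> (Suc k) x \<omega>"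
proof -
  have "state_at E \<mu> \<phi> (Suc k) x (fun_upd \<omega> k y) l = state_at E \<mu> \<phi> (Suc k) x \<omega> l" for l
    by (rule state_at_cong) auto
  then show ?thesis by (auto simp: total_reward_def intro!: sum.cong)
qed

lemma total_reward_stop:
  "\<lbrakk>k < H; \<phi> k s = 1\<rbrakk> \<Longrightarrow> total_reward E fm \<mu> \<phi> k (Some s) \<omega> = stop_reward E fm k s"
  by (simp add: total_reward_step stage_reward_def terminal_reward_def succ_state_def total_reward_None)

lemma total_reward_continue:
  "\<lbrakk>k < H; \<phi> k s = 0\<rbrakk> \<Longrightarrow> total_reward E fm \<mu> \<phi> k (Some s) (fun_upd \<omega> k y) =
    cont_reward E fm k s (\<mu> k s) y +
    total_reward E fm \<mu> \<phi> (Suc k) (Some (transition E k s (\<mu> k s) y)) \<omega>"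
  by (simp add: total_reward_step stage_reward_def terminal_reward_def succ_state_def total_reward_fun_upd)

lemma
  shows stop_reward_measurable: "k \<le> H \<Longrightarrow> stop_reward E fm k \<in> borel_measurable \<S>"
    and cont_reward_measurable: "k < H \<Longrightarrow>
      (\<lambda>(s, y). cont_reward E fm k s (\<mu> k s) y) \<in> borel_measurable (\<S> \<Otimes>\<^sub>M borel)"
    and total_reward_integrable: "\<lbrakk>stopping_policy E \<phi>; k \<le> H; s \<in> space \<S>\<rbrakk> \<Longrightarrow>
      integrable (obs_law E \<mu> \<phi> (H - k) k (Some s)) (total_reward E fm \<mu> \<phi> k (Some s))"
  using well_def by (auto simp: well_defined_def)

section \<open>Values at the horizon, when stopping and when continuing\<close>

lemma value_fun_horizon:
  assumes "stopping_policy E \<phi>" "s \<in> space \<S>"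
  shows "value_fun E fm \<mu> \<phi> H s = stop_reward E fm H s"
proof -
  interpret prob_space "obs_law E \<mu> \<phi> 0 H (Some s)"
    by (rule prob_space_obs_law) (use assms in auto)
  show ?thesis
    by (simp add: value_fun_def total_reward_def state_at_start terminal_reward_def prob_space
        del: obs_law.simps)
qed

text \<open>After a stop the total reward is constant in the path, and the path law has mass
  1.\<close>

lemma value_fun_stop:
  assumes "stopping_policy E \<phi>" "k < H" "s \<in> space \<S>" "\<phi> k s = 1"
  shows "value_fun E fm \<mu> \<phi> k s = stop_reward E fm k s"
proof -
  interpret prob_space "obs_law E \<mu> \<phi> (H - k) k (Some s)"
    by (rule prob_space_obs_law) (use assms in auto)
  show ?thesis
    using assms by (simp add: value_fun_def total_reward_stop prob_space)
qed

text \<open>The law from stage \<open>k\<close> is a bind over the first observation.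
  \<open>well_defined\<close> gives integrability both from stage \<open>k\<close> and from every
  successor state, the two integrability hypotheses of the bind formula above.\<close>

lemma
  assumes \<phi>: "stopping_policy E \<phi>" and k: "k < H" and s: "s \<in> space \<S>" and cont: "\<phi> k s = 0"
  shows value_fun_continue: "value_fun E fm \<mu> \<phi> k s = cont_value E fm \<mu> \<phi> k s (\<mu> k s)"
    and integrable_continue: "integrable (predictive E k s (\<mu> k s))
      (\<lambda>y. cont_reward E fm k s (\<mu> k s) y + value_fun E fm \<mu> \<phi> (Suc k) (transition E k s (\<mu> k s) y))"
proof -
  obtain m where m: "H - k = Suc m" "H - Suc k = m" "Suc k + m \<le> H" "k + Suc m \<le> H"
    using k by (cases "H - k") auto
  let ?P = "predictive E k s (\<mu> k s)" and ?s' = "transition E k s (\<mu> k s)"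
  let ?R = "\<lambda>y. obs_law E \<mu> \<phi> m (Suc k) (Some (?s' y))"
  let ?K = "\<lambda>y. distr (?R y) (paths k (Suc m)) (\<lambda>\<omega>. fun_upd \<omega> k y)"
  let ?f = "total_reward E fm \<mu> \<phi> k (Some s)"
  have law: "obs_law E \<mu> \<phi> (H - k) k (Some s) = ?P \<bind> ?K"
    using cont by (simp add: m obs_kernel_def succ_state_def)
  have f: "integrable (?P \<bind> ?K) ?f"
    using total_reward_integrable[OF \<phi> _ s, of k] k by (simp add: law)
  \<comment> \<open>Measurability of the total reward is read off from its integrability, since the
    path law carries the product sigma-algebra.\<close>
  have f_meas: "?f \<in> borel_measurable (paths k (Suc m))"
    using borel_measurable_integrable[OF total_reward_integrable[OF \<phi> _ s, of k]]
      sets_obs_law[OF \<phi> m(4) s] k by (simp add: m cong: measurable_cong_sets)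
  have R: "?R \<in> borel \<rightarrow>\<^sub>M prob_algebra (paths (Suc k) m)"
    by (rule measurable_compose[OF next_state_measurable1[OF k s] obs_law_kernel[OF \<phi> m(3)]])
  have "(\<lambda>(y, \<omega>). fun_upd \<omega> k y) \<in> borel \<Otimes>\<^sub>M paths (Suc k) m \<rightarrow>\<^sub>M paths k (Suc m)"
    using measurable_compose[OF measurable_pair_swap' path_extend_measurable[of k m]]
    by (simp add: case_prod_unfold)
  from measurable_distr_prob_space2[OF R this]
  have K: "?K \<in> ?P \<rightarrow>\<^sub>M subprob_algebra (paths k (Suc m))"
    by (intro measurable_prob_algebraD) (simp cong: measurable_cong_sets)
  have ext: "(\<lambda>\<omega>. fun_upd \<omega> k y) \<in> ?R y \<rightarrow>\<^sub>M paths k (Suc m)" for y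
  proof -
    have "(\<lambda>\<omega>. fun_upd \<omega> k y) \<in> paths (Suc k) m \<rightarrow>\<^sub>M paths k (Suc m)"
      using measurable_compose[OF measurable_Pair2' path_extend_measurable[of k m], of y] by simp
    then show ?thesis
      using sets_obs_law[OF \<phi> m(3) next_state_in_states[OF k s]]
      by (simp cong: measurable_cong_sets)
  qed
  have int': "integrable (?R y) (total_reward E fm \<mu> \<phi> (Suc k) (Some (?s' y)))" for y
    using total_reward_integrable[OF \<phi> _ next_state_in_states[OF k s], of "Suc k"] k by (simp add: m)
  have prob': "prob_space (?R y)" for y
    by (rule prob_space_obs_law[OF \<phi> m(3) next_state_in_states[OF k s]])
  have inner_int: "integrable (?K y) ?f" for y
  proof -
    interpret prob_space "?R y" by (rule prob')
    show ?thesis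
      unfolding integrable_distr_eq[OF ext f_meas]
      using int'[of y] by (simp add: total_reward_continue k cont)
  qed
  \<comment> \<open>Pulling back along the update at \<open>k\<close> separates the reward of stage
    \<open>k\<close>, constant under \<open>?R y\<close>, from the later total reward.\<close>
  have inner: "(LINT \<omega>|?K y. ?f \<omega>) =
      cont_reward E fm k s (\<mu> k s) y + value_fun E fm \<mu> \<phi> (Suc k) (?s' y)" for y
  proof -
    interpret prob_space "?R y" by (rule prob')
    show ?thesis
      unfolding integral_distr[OF ext f_meas]
      using int'[of y]
      by (simp add: total_reward_continue k cont value_fun_def m prob_space)
  qed
  show "integrable ?P (\<lambda>y. cont_reward E fm k s (\<mu> k s) y + value_fun E fm \<mu> \<phi> (Suc k) (?s' y))"
    using integrable_integral_bind[OF K f f_meas inner_int] by (simp only: inner)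
  show "value_fun E fm \<mu> \<phi> k s = cont_value E fm \<mu> \<phi> k s (\<mu> k s)"
    unfolding value_fun_def[of E fm \<mu> \<phi> k] law cont_value_def
    using integral_bind_integrable[OF K f f_meas inner_int] by (simp only: inner)
qed

text \<open>Backward induction with the Bellman equation. This locality is what keeps the greedy
  construction from being circular.\<close>

lemma value_fun_cong:
  assumes "stopping_policy E \<phi>" "stopping_policy E \<phi>'"
    and "k \<le> H" and "\<And>l. \<lbrakk>k \<le> l; l < H\<rbrakk> \<Longrightarrow> \<phi> l = \<phi>' l" and "s \<in> space \<S>"
  shows "value_fun E fm \<mu> \<phi> k s = value_fun E fm \<mu> \<phi>' k s"
  using \<open>k \<le> H\<close> \<open>s \<in> space \<S>\<close>
proof (induction arbitrary: s rule: inc_induct)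
  case base
  then show ?case using assms by (simp add: value_fun_horizon)
next
  case (step n)
  \<comment> \<open>The predictive law and the stage reward depend on the state and
    \<open>\<mu>\<close> alone; the stopping policy enters only through the value at stage
    \<open>Suc n\<close>.\<close>
  have "cont_value E fm \<mu> \<phi> n s (\<mu> n s) = cont_value E fm \<mu> \<phi>' n s (\<mu> n s)"
    using step by (simp add: cont_value_def next_state_in_states)
  then show ?case
    using stopping_policy_in[OF assms(1) step.hyps(2) step.prems] step assms
    by (auto simp: value_fun_stop value_fun_continue)
qed

text \<open>Agreement is asked only strictly after \<open>k\<close>, so the decision at stage
  \<open>k\<close> can be redefined from its own continuation value.\<close>

lemma cont_value_cong:
  assumes "stopping_policy E \<phi>" "stopping_policy E \<phi>'"
    and "k < H" and "\<And>l. \<lbrakk>k < l; l < H\<rbrakk> \<Longrightarrow> \<phi> l = \<phi>' l" and "s \<in> space \<S>"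
  shows "cont_value E fm \<mu> \<phi> k s (\<mu> k s) = cont_value E fm \<mu> \<phi>' k s (\<mu> k s)"
proof -
  have "value_fun E fm \<mu> \<phi> (Suc k) (transition E k s (\<mu> k s) y) =
      value_fun E fm \<mu> \<phi>' (Suc k) (transition E k s (\<mu> k s) y)" for y
    using assms by (intro value_fun_cong next_state_in_states) auto
  then show ?thesis by (simp add: cont_value_def)
qed

section \<open>Modified policies, integrability and measurability of values\<close>

lemma stopping_policy_update:
  assumes "stopping_policy E \<phi>" "f \<in> \<S> \<rightarrow>\<^sub>M count_space {0, 1}"
  shows "stopping_policy E (fun_upd \<phi> k f)"
  using assms by (auto simp: stopping_policy_def)

lemma stopping_policy_const: "stopping_policy E (\<lambda>_ _. 0)"
  by (simp add: stopping_policy_def)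

text \<open>At a state where \<open>\<phi>\<close> stops, \<open>well_defined\<close> says nothing about its continuation value;
  the policy that continues there and agrees with \<open>\<phi>\<close> afterwards provides the integrability.\<close>

lemma cont_value_integrable:
  assumes \<phi>: "stopping_policy E \<phi>" and k: "k < H" and s: "s \<in> space \<S>"
  shows "integrable (predictive E k s (\<mu> k s))
    (\<lambda>y. cont_reward E fm k s (\<mu> k s) y + value_fun E fm \<mu> \<phi> (Suc k) (transition E k s (\<mu> k s) y))"
proof -
  let ?\<phi>' = "fun_upd \<phi> k (\<lambda>_. 0)"
  have \<phi>': "stopping_policy E ?\<phi>'"
    by (rule stopping_policy_update[OF \<phi>]) simp
  have "value_fun E fm \<mu> ?\<phi>' (Suc k) (transition E k s (\<mu> k s) y) =
      value_fun E fm \<mu> \<phi> (Suc k) (transition E k s (\<mu> k s) y)" for y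
    using \<phi> \<phi>' k s by (intro value_fun_cong next_state_in_states) auto
  then show ?thesis
    using integrable_continue[OF \<phi>' k s] by simp
qed

lemma cont_value_measurable:
  assumes k: "k < H" and [measurable]: "value_fun E fm \<mu> \<phi> (Suc k) \<in> borel_measurable \<S>"
  shows "(\<lambda>s. cont_value E fm \<mu> \<phi> k s (\<mu> k s)) \<in> borel_measurable \<S>"
proof -
  note [measurable] = next_state_measurable[OF k] cont_reward_measurable[OF k]
  show ?thesis
    unfolding cont_value_def
    by (rule integral_measurable_subprob_algebra2[OF _ measurable_prob_algebraD[OF predictive_kernel[OF k]]])
      measurable
qed

text \<open>Backward induction: the Bellman equation presents the value as two measurable functions
  glued along the continuation set. It makes the stopping sets measurable, hence the greedy policy
  admissible.\<close>

lemma value_fun_measurable: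
  assumes \<phi>: "stopping_policy E \<phi>" and "k \<le> H"
  shows "value_fun E fm \<mu> \<phi> k \<in> borel_measurable \<S>"
  using \<open>k \<le> H\<close>
proof (induction rule: inc_induct)
  case base
  show ?case
    by (rule measurable_cong[THEN iffD1, OF _ stop_reward_measurable[OF order_refl]])
      (simp add: value_fun_horizon[OF \<phi>])
next
  case (step n)
  have "(\<lambda>s. if \<phi> n s = 0 then cont_value E fm \<mu> \<phi> n s (\<mu> n s) else stop_reward E fm n s)
      \<in> borel_measurable \<S>"
    using step.hyps stop_reward_measurable[of n]
    by (intro measurable_If cont_value_measurable step.IH continue_measurable[OF \<phi>]) auto
  then show ?case
  proof (rule measurable_cong[THEN iffD1, rotated], goal_cases)
    case (1 s)
    then show ?case
      using stopping_policy_in[OF \<phi> step.hyps(2) 1]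
      by (auto simp: value_fun_stop value_fun_continue \<phi> step.hyps)
  qed
qed

section \<open>The optimal stopping policy\<close>

text \<open>The condition refers to \<open>\<phi>\<close> on both sides, but the stopping set at
  \<open>k\<close> involves only the decisions after \<open>k\<close>, so it can be solved backward
  in \<open>k\<close>.\<close>

definition greedy :: "'s stopping \<Rightarrow> nat \<Rightarrow> bool" where
  "greedy \<phi> k \<longleftrightarrow> (\<forall>s\<in>space \<S>. \<phi> k s = indicator (stopping_set E fm \<mu> \<phi> k) s)"

lemma stopping_set_sets:
  assumes "stopping_policy E \<phi>" "k < H"
  shows "stopping_set E fm \<mu> \<phi> k \<in> sets \<S>"
  using stop_reward_measurable[of k] assms
    cont_value_measurable[OF assms(2) value_fun_measurable[OF assms(1)]]
  unfolding stopping_set_def by (intro borel_measurable_le) auto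

lemma ex_greedy:
  assumes "j \<le> H"
  shows "\<exists>\<phi>. stopping_policy E \<phi> \<and> (\<forall>k. j \<le> k \<and> k < H \<longrightarrow> greedy \<phi> k)"
  using assms
proof (induction rule: inc_induct)
  case base
  \<comment> \<open>At the horizon the range of stages is empty, so any admissible policy serves as
    a start.\<close>
  show ?case using stopping_policy_const by (intro exI[of _ "\<lambda>_ _. 0"]) auto
next
  case (step n)
  then obtain \<phi> where \<phi>: "stopping_policy E \<phi>" and greedy: "\<And>k. \<lbrakk>n < k; k < H\<rbrakk> \<Longrightarrow> greedy \<phi> k"
    by (auto simp: Suc_le_eq)
  let ?T = "stopping_set E fm \<mu> \<phi> n"
  let ?\<phi>' = "fun_upd \<phi> n (indicator ?T)"
  have "indicator ?T \<in> \<S> \<rightarrow>\<^sub>M count_space {0, 1 :: nat}"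
    unfolding indicator_def[abs_def] of_bool_def
    using stopping_set_sets[OF \<phi> step.hyps(2)] sets.sets_into_space[OF stopping_set_sets[OF \<phi> step.hyps(2)]]
    by (intro measurable_If) (auto simp: Int_def[symmetric] Int_absorb1 conj_commute)
  then have \<phi>': "stopping_policy E ?\<phi>'"
    by (rule stopping_policy_update[OF \<phi>])
  \<comment> \<open>The policies differ at stage \<open>n\<close> only, and continuation values at
    \<open>k \<ge> n\<close> look strictly beyond \<open>k\<close>; hence later stages stay greedy
    and stage \<open>n\<close> becomes so.\<close>
  have "stopping_set E fm \<mu> ?\<phi>' k = stopping_set E fm \<mu> \<phi> k" if "n \<le> k" "k < H" for k
    unfolding stopping_set_def[of E fm \<mu> _ k]
    using that by (intro Collect_cong conj_cong refl) (simp add: cont_value_cong[OF \<phi>' \<phi>])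
  then have "greedy ?\<phi>' k" if "n \<le> k" "k < H" for k
    using that greedy[of k] by (auto simp: greedy_def)
  with \<phi>' show ?case by blast
qed

text \<open>The greedy rule selects the larger alternative; a tie is resolved by stopping, with the
  same value.\<close>

lemma value_fun_greedy:
  assumes \<phi>: "stopping_policy E \<phi>" and "greedy \<phi> k" and "k < H" and s: "s \<in> space \<S>"
  shows "value_fun E fm \<mu> \<phi> k s = max (stop_reward E fm k s) (cont_value E fm \<mu> \<phi> k s (\<mu> k s))"
  using assms value_fun_stop[OF \<phi> _ s, of k] value_fun_continue[OF \<phi> _ s, of k]
  by (cases "s \<in> stopping_set E fm \<mu> \<phi> k") (auto simp: greedy_def stopping_set_def)

text \<open>A rival obtains either the stopping reward or its own continuation value. The latter is
  dominated by induction, and the greedy value is the maximum of both. Comparing at every state lets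
  the induction pass through all successor states.\<close>

lemma value_fun_le_greedy:
  assumes \<phi>: "stopping_policy E \<phi>" and greedy: "\<And>k. k < H \<Longrightarrow> greedy \<phi> k"
    and \<phi>': "stopping_policy E \<phi>'" and "k \<le> H" and "s \<in> space \<S>"
  shows "value_fun E fm \<mu> \<phi>' k s \<le> value_fun E fm \<mu> \<phi> k s"
  using \<open>k \<le> H\<close> \<open>s \<in> space \<S>\<close>
proof (induction arbitrary: s rule: inc_induct)
  case base
  then show ?case by (simp add: value_fun_horizon \<phi> \<phi>')
next
  case (step n)
  \<comment> \<open>Monotonicity of the Bochner integral needs both integrands integrable, also at
    states where either policy stops; \<open>cont_value_integrable\<close> covers these.\<close>
  have "cont_value E fm \<mu> \<phi>' n s (\<mu> n s) \<le> cont_value E fm \<mu> \<phi> n s (\<mu> n s)"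
    unfolding cont_value_def
    using step by (intro integral_mono cont_value_integrable \<phi> \<phi>') (auto simp: next_state_in_states)
  then show ?case
    using stopping_policy_in[OF \<phi>' step.hyps(2) step.prems] step.hyps step.prems
    by (auto simp: value_fun_greedy \<phi> greedy value_fun_stop[OF \<phi>'] value_fun_continue[OF \<phi>'])
qed

end

theorem theorem3p1:
  fixes E :: "('p::finite, 'd::finite, 'n::finite, 's) design_problem"
    and fm :: formulation
    and \<mu> :: "('d, 's) policy"
  assumes "bayesian_design E"
    and "design_policy E \<mu>"
    and "well_defined E fm \<mu>"
  shows "\<exists>\<phi>. stopping_policy E \<phi>
    \<and> (\<forall>\<phi>'. stopping_policy E \<phi>' \<longrightarrow> expected_utility E fm \<mu> \<phi>' \<le> expected_utility E fm \<mu> \<phi>)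
    \<and> (\<forall>k<horizon E. \<forall>s\<in>space (states E).
         \<phi> k s = indicator (stopping_set E fm \<mu> \<phi> k) s
         \<and> (\<phi> k s = 1 \<longleftrightarrow>
              stop_reward E fm k s \<ge>
              (LINT y|predictive E k s (\<mu> k s). cont_reward E fm k s (\<mu> k s) y
                 + value_fun E fm \<mu> \<phi> (Suc k) (transition E k s (\<mu> k s) y))))"
proof -
  interpret bayesian_design E by (rule assms)
  interpret sequential_design E fm \<mu> by unfold_locales (use assms in auto)
  obtain \<phi> where \<phi>: "stopping_policy E \<phi>" and greedy: "\<And>k. k < H \<Longrightarrow> greedy \<phi> k"
    using ex_greedy[of 0] by auto
  \<comment> \<open>With start stage 0, \<open>horizon E - 0\<close> observations remain, so utility
    and initial value are the same integral.\<close>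
  have "expected_utility E fm \<mu> \<phi>' = value_fun E fm \<mu> \<phi>' 0 (init E)" for \<phi>'
    by (simp add: expected_utility_def value_fun_def)
  then have "expected_utility E fm \<mu> \<phi>' \<le> expected_utility E fm \<mu> \<phi>" if "stopping_policy E \<phi>'" for \<phi>'
    using value_fun_le_greedy[OF \<phi> greedy that _ init_state] by simp
  moreover have "\<phi> k s = indicator (stopping_set E fm \<mu> \<phi> k) s
      \<and> (\<phi> k s = 1 \<longleftrightarrow> stop_reward E fm k s \<ge> cont_value E fm \<mu> \<phi> k s (\<mu> k s))"
    if "k < H" "s \<in> space \<S>" for k s
    using greedy[OF that(1)] that(2) by (auto simp: greedy_def stopping_set_def indicator_def)
  ultimately show ?thesis
    using \<phi> unfolding cont_value_def by blast
qed

end
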